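(* Let $P \in \mathcal{C}(G_n)$, and let $k \in Q_n$. Then the following are equivalent: (1) The set $\{k\}$ is separable with respect to $P$. (2) The $k^{th}$ column of $P$ is of the form $\begin{pmatrix} 1 & 1 & \cdots & 1 & 0 & \cdots & 0 \end{pmatrix}^\top$ (first $2^{n-1}$ entries $1$, last $2^{n-1}$ entries $0$), or its bitwise complement. (3) The matrix $P$ is equal to $P_1 \,\mathrm{stack}_k^1\, P_2$ or $P_1 \,\mathrm{stack}_k^0\, P_2$ for some $P_1 \in \mathcal{C}(G_{n-1})$ and $P_2 \in \mathcal{S}(P_1)$.
   Context: Let $Q_n=\{1,\dots,n\}$ be a set of $n$ yes/no questions; an outcome on $S\subseteq Q_n$ is an element of $\{0,1\}^{|S|}$. A preference matrix on $Q_n$ is a $2^n\times n$ 0-1 matrix whose rows are the $2^n$ outcomes, each exactly once, ordered from most to least preferred. For a nonempty proper $S\subset Q_n$ and outcome $x$ on $Q_n-S$, $P^{[Q_n-S,x]}$ is the submatrix formed by the columns in $S$ and rows with outcome $x$ on $Q_n-S$ (in order); $S$ is separable with respect to $P$ if all these submatrices coincide for all $x$. $\mathcal{C}(G_n)$ is the set of preference matrices generated by Hamiltonian paths in the $n$-dimensional hypercube graph $G_n$ with Gray code labeling, i.e. preference matrices in which consecutive rows differ in exactly one entry. For $A\in\mathcal{C}(G_{n-1})$, $\mathcal{S}(A)$ is the set of $B\in\mathcal{C}(G_{n-1})$ whose first row equals the last row of $A$. For $B\in\mathcal{S}(A)$ and $k\in\{1,\dots,n\}$, $A\,\mathrm{stack}_k^1\,B$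 is the $2^{n}\times n$ matrix obtained by placing $A$ above $B$ and inserting a new column in position $k$ (shifting later columns right) whose top half entries are $1$ and bottom half entries are $0$; $A\,\mathrm{stack}_k^0\,B$ is the same but with the new column bitwise complemented. *)

theory Defs
  imports
    "Jordan_Normal_Form.Determinant"
    "Jordan_Normal_Form.DL_Submatrix"
    "Graph_Theory.Graph_Theory"
    "HOL-Library.Z2"
begin

text \<open>
  Questions, rows and columns are counted from 0, so that they agree with matrix and vector
  indices: question \<open>k\<close> of \<open>{1, \<dots>, n}\<close> is here \<open>k - 1\<close>. The type \<^typ>\<open>bit\<close> serves only
  as a two-element set of matrix entries, with \<open>1 - b\<close> the complement of \<open>b\<close>.
\<close>

definition questions :: "nat \<Rightarrow> nat set" where
  "questions n = {..<n}"

definition outcomes :: "nat \<Rightarrow> bit vec set" where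
  "outcomes m = carrier_vec m"

definition preference_matrix :: "nat \<Rightarrow> bit mat \<Rightarrow> bool" where
  "preference_matrix n P \<longleftrightarrow>
     P \<in> carrier_mat (2 ^ n) n \<and> distinct (rows P) \<and> set (rows P) = outcomes n"

text \<open>The outcome on the questions in \<open>T\<close> that is part of the outcome \<open>v\<close>, the questions of \<open>T\<close>
  being taken in increasing order (\<open>pick T j\<close> is the \<open>j\<close>-th smallest element of \<open>T\<close>).\<close>

definition restrict_outcome :: "nat set \<Rightarrow> bit vec \<Rightarrow> bit vec" where
  "restrict_outcome T v = vec (card T) (\<lambda>j. v $ pick T j)"

text \<open>\<open>conditional_submatrix n P T x\<close> is $P^{[T,x]}$: the rows with outcome \<open>x\<close> on \<open>T\<close>, and
  the columns outside \<open>T\<close>.\<close>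

definition conditional_submatrix :: "nat \<Rightarrow> bit mat \<Rightarrow> nat set \<Rightarrow> bit vec \<Rightarrow> bit mat" where
  "conditional_submatrix n P T x =
     submatrix P {i. i < dim_row P \<and> restrict_outcome T (row P i) = x} (questions n - T)"

text \<open>Meant for \<open>S \<subseteq> questions n\<close>. The empty set and \<open>questions n\<close> itself are not excluded; both
  come out as trivially separable, the latter because the only outcome on the empty set of
  questions is the empty one. For a singleton this matters only when \<open>n = 1\<close>.\<close>

definition separable :: "nat \<Rightarrow> bit mat \<Rightarrow> nat set \<Rightarrow> bool" where
  "separable n P S \<longleftrightarrow>
     (\<forall>x \<in> outcomes (card (questions n - S)). \<forall>y \<in> outcomes (card (questions n - S)).
        conditional_submatrix n P (questions n - S) x =
        conditional_submatrix n P (questions n - S) y)"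

definition hypercube :: "nat \<Rightarrow> bit vec pair_pre_digraph" where
  "hypercube n =
     \<lparr> pverts = outcomes n,
       parcs = {(u, v). u \<in> outcomes n \<and> v \<in> outcomes n \<and> card {j. j < n \<and> u $ j \<noteq> v $ j} = 1} \<rparr>"

definition hamiltonian_path :: "'a list \<Rightarrow> ('a, 'b) pre_digraph \<Rightarrow> bool" where
  "hamiltonian_path p G \<longleftrightarrow> vpath p G \<and> set p = verts G"

definition gray_matrices :: "nat \<Rightarrow> bit mat set" where
  "gray_matrices n =
     {P. preference_matrix n P \<and> hamiltonian_path (rows P) (with_proj (hypercube n))}"

lemma vwalk_arcs_conv_zip: "vwalk_arcs p = zip p (tl p)"
  by (induction p rule: vwalk_arcs.induct) auto

lemma vwalk_arcs_subset_iff: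
  "set (vwalk_arcs p) \<subseteq> E \<longleftrightarrow> (\<forall>i. Suc i < length p \<longrightarrow> (p ! i, p ! Suc i) \<in> E)"
proof -
  have arcs: "e \<in> set (vwalk_arcs p) \<longleftrightarrow> (\<exists>i. Suc i < length p \<and> e = (p ! i, p ! Suc i))" for e
    unfolding vwalk_arcs_conv_zip set_zip mem_Collect_eq
    by (intro ex_cong1) (auto simp: nth_tl)
  show ?thesis
    unfolding subset_iff arcs by auto
qed

lemma gray_matrices_iff:
  "P \<in> gray_matrices n \<longleftrightarrow>
     preference_matrix n P \<and>
     (\<forall>i. Suc i < 2 ^ n \<longrightarrow> (\<exists>!j. j < n \<and> P $$ (i, j) \<noteq> P $$ (Suc i, j)))"
proof (cases "preference_matrix n P")
  case True
  then have P: "P \<in> carrier_mat (2 ^ n) n" and d: "distinct (rows P)"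
    and s: "set (rows P) = outcomes n"
    by (auto simp: preference_matrix_def)
  have ne: "rows P \<noteq> []" using P by (auto simp: rows_def)
  have ends: "arcs_ends (with_proj (hypercube n)) = parcs (hypercube n)"
    by (auto simp: arcs_ends_def arc_to_ends_def with_proj_def)
  have "hamiltonian_path (rows P) (with_proj (hypercube n)) \<longleftrightarrow>
      set (vwalk_arcs (rows P)) \<subseteq> parcs (hypercube n)"
    using d s ne ends by (auto simp: hamiltonian_path_def vpath_def vwalk_def hypercube_def)
  also have "\<dots> \<longleftrightarrow>
      (\<forall>i. Suc i < 2 ^ n \<longrightarrow> (row P i, row P (Suc i)) \<in> parcs (hypercube n))"
    unfolding vwalk_arcs_subset_iff
  proof (intro all_cong1 imp_cong)
    show "Suc i < length (rows P) \<longleftrightarrow> Suc i < 2 ^ n" for i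
      using P by simp
    show "(rows P ! i, rows P ! Suc i) \<in> parcs (hypercube n) \<longleftrightarrow>
        (row P i, row P (Suc i)) \<in> parcs (hypercube n)" if "Suc i < 2 ^ n" for i
      using P that by simp
  qed
  also have "\<dots> \<longleftrightarrow>
      (\<forall>i. Suc i < 2 ^ n \<longrightarrow> card {j. j < n \<and> P $$ (i, j) \<noteq> P $$ (Suc i, j)} = 1)"
  proof (intro all_cong1 imp_cong refl)
    fix i :: nat
    assume i: "Suc i < 2 ^ n"
    have "{j. j < n \<and> row P i $ j \<noteq> row P (Suc i) $ j} =
        {j. j < n \<and> P $$ (i, j) \<noteq> P $$ (Suc i, j)}"
      using P i by auto
    then show "(row P i, row P (Suc i)) \<in> parcs (hypercube n) \<longleftrightarrow>
        card {j. j < n \<and> P $$ (i, j) \<noteq> P $$ (Suc i, j)} = 1"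
      using P row_carrier[of P i] row_carrier[of P "Suc i"]
      by (simp add: hypercube_def outcomes_def)
  qed
  finally have "hamiltonian_path (rows P) (with_proj (hypercube n)) \<longleftrightarrow>
      (\<forall>i. Suc i < 2 ^ n \<longrightarrow> card {j. j < n \<and> P $$ (i, j) \<noteq> P $$ (Suc i, j)} = 1)" .
  moreover have "card {j. j < n \<and> Q j} = 1 \<longleftrightarrow> (\<exists>!j. j < n \<and> Q j)" for Q
  proof -
    have "card {j. j < n \<and> Q j} = 1 \<longleftrightarrow> (\<exists>j. {j. j < n \<and> Q j} = {j})"
      by (simp add: card_1_singleton_iff)
    also have "\<dots> \<longleftrightarrow> (\<exists>!j. j < n \<and> Q j)"
      unfolding Ex1_def Set.set_eq_iff by blast
    finally show ?thesis .
  qed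
  ultimately show ?thesis using True by (simp add: gray_matrices_def)
qed (simp add: gray_matrices_def)

definition successors :: "nat \<Rightarrow> bit mat \<Rightarrow> bit mat set" where
  "successors m A = {B \<in> gray_matrices m. row B 0 = row A (dim_row A - 1)}"

definition ones_zeros :: "nat \<Rightarrow> bit vec" where
  "ones_zeros m = vec (2 * m) (\<lambda>i. if i < m then 1 else 0)"

definition complement :: "bit vec \<Rightarrow> bit vec" where
  "complement v = map_vec (\<lambda>b. 1 - b) v"

definition insert_col :: "nat \<Rightarrow> 'a vec \<Rightarrow> 'a mat \<Rightarrow> 'a mat" where
  "insert_col k c A = mat (dim_row A) (Suc (dim_col A))
     (\<lambda>(i, j). if j = k then c $ i else A $$ (i, delete_index k j))"

definition stack1 :: "nat \<Rightarrow> bit mat \<Rightarrow> bit mat \<Rightarrow> bit mat" where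
  "stack1 k A B = insert_col k (ones_zeros (dim_row A)) (A @\<^sub>r B)"

definition stack0 :: "nat \<Rightarrow> bit mat \<Rightarrow> bit mat \<Rightarrow> bit mat" where
  "stack0 k A B = insert_col k (complement (ones_zeros (dim_row A))) (A @\<^sub>r B)"

end

theory Submission
  imports Defs
begin

text \<open>
  Pair up the outcomes that differ only in question \<open>k\<close>. The set \<open>{k}\<close> is separable iff one value
  \<open>b\<close> of question \<open>k\<close> comes first in every pair. In a Gray matrix two consecutive rows that differ
  in column \<open>k\<close> form such a pair, so under separability column \<open>k\<close> never changes from \<open>1 - b\<close> to
  \<open>b\<close>; as either value occurs in half of the rows, the first half of the column is \<open>b\<close> and the
  second half is \<open>1 - b\<close>. Such a column cuts the matrix into two Gray matrices on the other
  questions, and the only change of column \<open>k\<close> makes them agree on the rows adjacent to the cut.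
\<close>

section \<open>Vectors with one entry removed or inserted\<close>

definition remove_entry :: "nat \<Rightarrow> 'a vec \<Rightarrow> 'a vec" where
  "remove_entry k v = vec (dim_vec v - 1) (\<lambda>j. v $ insert_index k j)"

definition insert_entry :: "nat \<Rightarrow> 'a \<Rightarrow> 'a vec \<Rightarrow> 'a vec" where
  "insert_entry k b v = vec (Suc (dim_vec v)) (\<lambda>j. if j = k then b else v $ delete_index k j)"

lemma insert_index_less: "j < m \<Longrightarrow> insert_index k j < Suc m"
  by (simp add: insert_index_def)

lemma delete_index_less: "j < Suc m \<Longrightarrow> k < Suc m \<Longrightarrow> j \<noteq> k \<Longrightarrow> delete_index k j < m"
  by (auto simp: delete_index_def)

lemma dim_insert_entry [simp]: "dim_vec (insert_entry k b v) = Suc (dim_vec v)"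
  by (simp add: insert_entry_def)

lemma insert_entry_nth [simp]: "k \<le> dim_vec v \<Longrightarrow> insert_entry k b v $ k = b"
  by (simp add: insert_entry_def)

lemma remove_insert_entry [simp]: "remove_entry k (insert_entry k b v) = v"
  by (rule eq_vecI)
    (auto simp: remove_entry_def insert_entry_def insert_index_less insert_index_exclude)

lemma remove_entry_eq_imp_eq:
  assumes "v \<in> carrier_vec (Suc m)" "w \<in> carrier_vec (Suc m)" "k < Suc m"
    and r: "remove_entry k v = remove_entry k w" and "v $ k = w $ k"
  shows "v = w"
proof (rule eq_vecI)
  fix j
  assume j: "j < dim_vec w"
  show "v $ j = w $ j"
  proof (cases "j = k")
    case False
    then have "delete_index k j < m" "insert_index k (delete_index k j) = j"
      using assms j by (auto simp: insert_delete_index intro!: delete_index_less)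
    then show ?thesis
      using arg_cong[OF r, of "\<lambda>u. u $ delete_index k j"] assms(1,2)
      by (simp add: remove_entry_def)
  qed (use assms in simp)
qed (use assms in simp)

section \<open>Restriction to all questions but one, and two-row submatrices\<close>

lemma pick_questions_diff_singleton:
  assumes "j < m"
  shows "pick (questions (Suc m) - {k}) j = insert_index k j"
proof -
  let ?T = "questions (Suc m) - {k}"
  \<comment> \<open>\<open>pick\<close> inverts counting the smaller elements. Below
    \<open>k\<close> nothing is missing; from \<open>k\<close> on the index is shifted to
    \<open>Suc j\<close> and \<open>k\<close> itself is left out, so the count is \<open>j\<close>
    in both cases.\<close>
  have "{a \<in> ?T. a < insert_index k j} = (if j < k then {..<j} else {..<Suc j} - {k})"
    using assms by (auto simp: questions_def insert_index_def)
  then have "card {a \<in> ?T. a < insert_index k j} = j"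
    by auto
  moreover have "insert_index k j \<in> ?T"
    using assms by (auto simp: questions_def insert_index_def)
  ultimately show ?thesis
    using pick_card_in_set[of "insert_index k j" ?T] by simp
qed

lemma card_questions_diff_singleton: "k < Suc m \<Longrightarrow> card (questions (Suc m) - {k}) = m"
  by (simp add: questions_def)

lemma restrict_outcome_questions_diff_singleton:
  "k < Suc m \<Longrightarrow> v \<in> carrier_vec (Suc m) \<Longrightarrow>
    restrict_outcome (questions (Suc m) - {k}) v = remove_entry k v"
  by (auto simp: restrict_outcome_def remove_entry_def card_questions_diff_singleton
      pick_questions_diff_singleton)

lemma pick_singleton: "pick {k} 0 = k"
  by (simp add: Least_equality)

lemma pick_doubleton:
  assumes "i < j"
  shows "pick {i, j} 0 = i" and "pick {i, j} (Suc 0) = j"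
proof -
  have "{a \<in> {i, j}. a < i} = {}" "{a \<in> {i, j}. a < j} = {i}"
    using assms by auto
  then have card: "card {a \<in> {i, j}. a < i} = 0" "card {a \<in> {i, j}. a < j} = Suc 0"
    by simp_all
  show "pick {i, j} 0 = i" "pick {i, j} (Suc 0) = j"
    using pick_card_in_set[of i "{i, j}", unfolded card]
      pick_card_in_set[of j "{i, j}", unfolded card] by blast+
qed

lemma submatrix_pair:
  assumes "i < j" "j < dim_row P" "k < dim_col P"
  shows "submatrix P {i, j} {k} = mat 2 1 (\<lambda>(a, _). if a = 0 then P $$ (i, k) else P $$ (j, k))"
proof -
  have "{a. a < dim_row P \<and> a \<in> {i, j}} = {i, j}" "{a. a < dim_col P \<and> a \<in> {k}} = {k}"
    using assms by auto
  then have "submatrix P {i, j} {k} = mat 2 1 (\<lambda>(a, b). P $$ (pick {i, j} a, pick {k} b))"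
    using assms unfolding submatrix_def by (simp add: numeral_2_eq_2)
  also have "\<dots> = mat 2 1 (\<lambda>(a, _). if a = 0 then P $$ (i, k) else P $$ (j, k))"
    using pick_doubleton[OF assms(1)] pick_singleton[of k]
    by (intro eq_matI) (auto simp: less_2_cases_iff simp del: pick.simps)
  finally show ?thesis .
qed

section \<open>Bits, initial segments and the shape of a column\<close>

lemma bit_eq_complement: "(x :: bit) \<noteq> y \<Longrightarrow> y = 1 - x"
  by (cases x; cases y) auto

lemma ex_bit_iff: "(\<exists>b :: bit. Q b) \<longleftrightarrow> Q 0 \<or> Q 1"
  by (metis bit.exhaust)

text \<open>Applied to the rows with value \<open>b\<close> in column \<open>k\<close>: if their set
  is closed under going up one row, its size alone determines where the value changes.\<close>

lemma down_closed_eq_lessThan_card: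
  fixes A :: "nat set"
  assumes "finite A" and down: "\<And>i. Suc i \<in> A \<Longrightarrow> i \<in> A"
  shows "A = {..<card A}"
proof -
  have le: "i \<in> A" if "i \<le> j" "j \<in> A" for i j
    using that by (induction rule: inc_induct) (auto intro: down)
  \<comment> \<open>Finiteness provides a least number \<open>t\<close> outside \<open>A\<close>. By
    \<open>le\<close>, nothing above \<open>t\<close> can belong to \<open>A\<close>.\<close>
  have "A = {..<t}" if "t = (LEAST i. i \<notin> A)" for t
  proof -
    have "\<exists>i. i \<notin> A"
      using \<open>finite A\<close> ex_new_if_finite infinite_UNIV_nat by blast
    then have "t \<notin> A"
      unfolding that by (rule LeastI_ex)
    moreover have "i \<in> A" if "i < t" for i
      using not_less_Least that \<open>t = _\<close> by blast
    ultimately show ?thesis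
      using le by (metis lessThan_iff linorder_not_less subsetI subset_antisym)
  qed
  then show ?thesis
    by (metis card_lessThan)
qed

lemma col_insert_col:
  "k \<le> dim_col A \<Longrightarrow> dim_vec v = dim_row A \<Longrightarrow> col (insert_col k v A) k = v"
  by (auto simp: insert_col_def)

lemma dim_ones_zeros [simp]: "dim_vec (ones_zeros m) = 2 * m"
  by (simp add: ones_zeros_def)

lemma dim_complement [simp]: "dim_vec (complement v) = dim_vec v"
  by (simp add: complement_def)

text \<open>The two vectors are the cases \<open>b = 1\<close> and \<open>b = 0\<close> of one
  condition, which has the same shape as the criterion for separability below.\<close>

lemma col_eq_ones_zeros_iff:
  assumes "dim_row P = 2 * h" "k < dim_col P"
  shows "col P k = ones_zeros h \<or> col P k = complement (ones_zeros h) \<longleftrightarrow>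
    (\<exists>b. \<forall>i < 2 * h. P $$ (i, k) = b \<longleftrightarrow> i < h)"
proof -
  have "col P k = ones_zeros h \<longleftrightarrow> (\<forall>i < 2 * h. P $$ (i, k) = 1 \<longleftrightarrow> i < h)"
    using assms by (auto simp: ones_zeros_def vec_eq_iff)
  moreover have "col P k = complement (ones_zeros h) \<longleftrightarrow>
      (\<forall>i < 2 * h. P $$ (i, k) = 0 \<longleftrightarrow> i < h)"
    using assms by (auto simp: ones_zeros_def complement_def vec_eq_iff)
  ultimately show ?thesis
    unfolding ex_bit_iff by blast
qed

section \<open>Rows that agree outside question k\<close>

locale gray_question =
  fixes m k :: nat and P :: "bit mat"
  assumes gray: "P \<in> gray_matrices (Suc m)" and k_less: "k < Suc m"
begin

abbreviation rest :: "nat \<Rightarrow> bit vec" where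
  "rest i \<equiv> remove_entry k (row P i)"

text \<open>The offset \<open>s\<close> is \<open>0\<close> for the upper half of \<open>P\<close>
  and \<open>2 ^ m\<close> for the lower half, so that one argument covers both.\<close>

definition slice :: "nat \<Rightarrow> bit mat" where
  "slice s = mat (2 ^ m) m (\<lambda>(i, j). P $$ (s + i, insert_index k j))"

lemma dims [simp]: "dim_row P = 2 * 2 ^ m" "dim_col P = Suc m"
  using gray by (auto simp: gray_matrices_iff preference_matrix_def)

lemma row_in_carrier: "row P i \<in> carrier_vec (Suc m)"
  by (metis dims(2) row_carrier)

lemma rest_in_carrier: "rest i \<in> carrier_vec m"
  by (simp add: remove_entry_def carrier_vecI)

lemma row_nth: "i < 2 * 2 ^ m \<Longrightarrow> row P i $ k = P $$ (i, k)"
  using k_less by simp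

lemma rest_inj:
  assumes "i < 2 * 2 ^ m" "j < 2 * 2 ^ m" "rest i = rest j" "P $$ (i, k) = P $$ (j, k)"
  shows "i = j"
proof -
  have "row P i = row P j"
    using assms(3) row_nth[OF assms(1)] row_nth[OF assms(2)] assms(4)
    by (intro remove_entry_eq_imp_eq[OF row_in_carrier row_in_carrier k_less]) metis+
  moreover have "distinct (rows P)"
    using gray by (simp add: gray_matrices_iff preference_matrix_def)
  ultimately show ?thesis
    using assms(1,2) by (simp add: distinct_conv_nth) (metis dims(1) nth_rows)
qed

lemma row_exists:
  assumes "x \<in> carrier_vec m"
  obtains i where "i < 2 * 2 ^ m" "rest i = x" "P $$ (i, k) = b"
proof -
  have "insert_entry k b x \<in> set (rows P)"
    using gray assms
    by (auto simp: gray_matrices_iff preference_matrix_def outcomes_def intro!: carrier_vecI)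
  then obtain i where "i < 2 * 2 ^ m" "row P i = insert_entry k b x"
    by (auto simp: in_set_conv_nth)
  then show ?thesis
    using that[of i] row_nth[of i] assms k_less by simp
qed

lemma partner_exists:
  assumes "x \<in> carrier_vec m"
  obtains i j where "i < j" "j < 2 * 2 ^ m" "rest i = x" "rest j = x"
proof -
  obtain i where i: "i < 2 * 2 ^ m" "rest i = x" "P $$ (i, k) = 0"
    using row_exists[OF assms] .
  obtain j where j: "j < 2 * 2 ^ m" "rest j = x" "P $$ (j, k) = 1"
    using row_exists[OF assms] .
  have "i \<noteq> j"
    using i j by auto
  then show ?thesis
    using that[of i j] that[of j i] i j by (cases "i < j") auto
qed

lemma partner_complement:
  "i < j \<Longrightarrow> j < 2 * 2 ^ m \<Longrightarrow> rest i = rest j \<Longrightarrow> P $$ (j, k) = 1 - P $$ (i, k)"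
  using rest_inj[of i j] by (intro bit_eq_complement) auto

text \<open>Consecutive rows of a Gray matrix differ in a single column. If that column is
  \<open>k\<close>, nothing else changes.\<close>

lemma rest_Suc:
  assumes i: "Suc i < 2 * 2 ^ m" and "P $$ (i, k) \<noteq> P $$ (Suc i, k)"
  shows "rest (Suc i) = rest i"
proof -
  have "\<exists>!j. j < Suc m \<and> P $$ (i, j) \<noteq> P $$ (Suc i, j)"
    using gray i by (simp add: gray_matrices_iff)
  then have "P $$ (i, j) = P $$ (Suc i, j)" if "j < Suc m" "j \<noteq> k" for j
    using that assms k_less by blast
  then show ?thesis
    using i by (auto simp: remove_entry_def insert_index_less insert_index_exclude)
qed

text \<open>For either value of question \<open>k\<close>, \<open>rest\<close> is a bijection from
  the rows with that value onto the outcomes on the other questions. The two classes thus have equal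
  size, and together they make up all \<open>2 * 2 ^ m\<close> rows.\<close>

lemma card_rows_value: "card {i. i < 2 * 2 ^ m \<and> P $$ (i, k) = b} = 2 ^ m"
proof -
  let ?R = "\<lambda>b. {i. i < 2 * 2 ^ m \<and> P $$ (i, k) = b}"
  have bij: "bij_betw rest (?R b) (carrier_vec m)" for b
    unfolding bij_betw_def
  proof (intro conjI equalityI subsetI)
    show "x \<in> rest ` ?R b" if "x \<in> carrier_vec m" for x
      using row_exists[OF that, of b] by blast
    show "inj_on rest (?R b)"
      by (rule inj_onI) (auto intro: rest_inj)
  qed (auto simp: rest_in_carrier)
  have "card (?R 0) = card (?R 1)"
    using bij[THEN bij_betw_same_card] by simp
  moreover have "?R 0 \<union> ?R 1 = {..<2 * 2 ^ m}"
    by auto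
  moreover have "card (?R 0 \<union> ?R 1) = card (?R 0) + card (?R 1)"
    by (rule card_Un_disjoint) auto
  ultimately show ?thesis
    by (cases b) simp_all
qed

section \<open>Separability as a condition on column k\<close>

lemma conditional_submatrix_pair:
  assumes "i < j" "j < 2 * 2 ^ m" "rest i = x" "rest j = x"
  shows "conditional_submatrix (Suc m) P (questions (Suc m) - {k}) x =
    mat 2 1 (\<lambda>(a, _). if a = 0 then P $$ (i, k) else P $$ (j, k))"
proof -
  \<comment> \<open>Rows \<open>i\<close> and \<open>j\<close> have opposite values in column
    \<open>k\<close>. Any row with the same rest shares its value with one of them and coincides
    with it by \<open>rest_inj\<close>.\<close>
  have "a = i \<or> a = j" if "a < 2 * 2 ^ m" "rest a = x" for a
    using that assms rest_inj[of a i] rest_inj[of a j] partner_complement[of i j]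
    by (metis bit_eq_complement less_trans)
  then have "{a. a < 2 * 2 ^ m \<and> rest a = x} = {i, j}"
    using assms by auto
  moreover have "questions (Suc m) - (questions (Suc m) - {k}) = {k}"
    using k_less by (auto simp: questions_def)
  ultimately show ?thesis
    using assms k_less
    by (simp add: conditional_submatrix_def submatrix_pair row_in_carrier
        restrict_outcome_questions_diff_singleton)
qed

text \<open>Each conditional submatrix is a column of two complementary entries, hence is determined
  by its top entry. All of them coincide iff the earlier row of every pair has the same value
  \<open>b\<close>.\<close>

lemma separable_iff:
  "separable (Suc m) P {k} \<longleftrightarrow>
    (\<exists>b. \<forall>i j. i < j \<longrightarrow> j < 2 * 2 ^ m \<longrightarrow> rest i = rest j \<longrightarrow> P $$ (i, k) = b)"
    (is "?L \<longleftrightarrow> ?R")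
proof
  let ?C = "conditional_submatrix (Suc m) P (questions (Suc m) - {k})"
  assume ?L
  then have eq: "?C x = ?C y" if "x \<in> carrier_vec m" "y \<in> carrier_vec m" for x y
    using that unfolding separable_def outcomes_def card_questions_diff_singleton[OF k_less]
    by blast
  \<comment> \<open>The zero vector is an arbitrary reference outcome; the top entry of its
    submatrix serves as \<open>b\<close>.\<close>
  have "P $$ (i, k) = ?C (0\<^sub>v m) $$ (0, 0)" if "i < j" "j < 2 * 2 ^ m" "rest i = rest j" for i j
  proof -
    have "?C (rest j) $$ (0, 0) = P $$ (i, k)"
      unfolding conditional_submatrix_pair[OF that refl] by simp
    then show ?thesis
      using eq[OF zero_carrier_vec rest_in_carrier, of j] by metis
  qed
  then show ?R
    by blast
next
  let ?C = "conditional_submatrix (Suc m) P (questions (Suc m) - {k})"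
  assume ?R
  then obtain b where
    b: "\<And>i j. i < j \<Longrightarrow> j < 2 * 2 ^ m \<Longrightarrow> rest i = rest j \<Longrightarrow> P $$ (i, k) = b"
    by blast
  have "?C x = mat 2 1 (\<lambda>(a, _). if a = 0 then b else 1 - b)" if x: "x \<in> carrier_vec m" for x
  proof -
    obtain i j where ij: "i < j" "j < 2 * 2 ^ m" "rest i = x" "rest j = x"
      using partner_exists[OF x] .
    then have "P $$ (i, k) = b" "P $$ (j, k) = 1 - b"
      using b[of i j] partner_complement[of i j] by simp_all
    then show ?thesis
      by (simp only: conditional_submatrix_pair[OF ij])
  qed
  then show ?L
    using k_less by (simp add: separable_def outcomes_def card_questions_diff_singleton)
qed

lemma separable_iff_halves:
  "separable (Suc m) P {k} \<longleftrightarrow> (\<exists>b. \<forall>i < 2 * 2 ^ m. P $$ (i, k) = b \<longleftrightarrow> i < 2 ^ m)"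
  unfolding separable_iff
proof (rule ex_cong1, rule iffI; intro allI impI)
  fix b and i :: nat
  assume b: "\<forall>i j. i < j \<longrightarrow> j < 2 * 2 ^ m \<longrightarrow> rest i = rest j \<longrightarrow> P $$ (i, k) = b"
    and i: "i < 2 * 2 ^ m"
  let ?A = "{i. i < 2 * 2 ^ m \<and> P $$ (i, k) = b}"
  \<comment> \<open>If row \<open>i\<close> did not have value \<open>b\<close>, rows
    \<open>i\<close> and \<open>Suc i\<close> would differ in column \<open>k\<close> and so form a
    pair by \<open>rest_Suc\<close>; then \<open>b\<close> would have to come first.\<close>
  have "i \<in> ?A" if "Suc i \<in> ?A" for i
    using that b[rule_format, of i "Suc i"] rest_Suc[of i]
    by (cases "P $$ (i, k) = P $$ (Suc i, k)") auto
  then have "?A = {..<2 ^ m}"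
    using down_closed_eq_lessThan_card[of ?A] by (simp add: card_rows_value)
  then show "P $$ (i, k) = b \<longleftrightarrow> i < 2 ^ m"
    using i by auto
next
  fix b i j
  assume b: "\<forall>i < 2 * 2 ^ m. P $$ (i, k) = b \<longleftrightarrow> i < 2 ^ m"
    and ij: "i < j" "j < 2 * 2 ^ m" "rest i = rest j"
  \<comment> \<open>One member of the pair has value \<open>b\<close> and therefore lies in the
    upper half. As \<open>i < j\<close>, row \<open>i\<close> lies there in either case.\<close>
  have "P $$ (i, k) = b \<or> P $$ (j, k) = b"
    using bit_eq_complement[of "P $$ (i, k)" b] partner_complement[OF ij] by auto
  then show "P $$ (i, k) = b"
    using b ij by auto
qed

section \<open>Cutting the matrix into two halves\<close>

lemma row_slice: "i < 2 ^ m \<Longrightarrow> s + i < 2 * 2 ^ m \<Longrightarrow> row (slice s) i = rest (s + i)"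
  by (auto simp: slice_def remove_entry_def insert_index_less)

text \<open>The window of rows starting at \<open>s\<close> consists of exactly the rows with value
  \<open>b\<close> in column \<open>k\<close>. Hence removing that column keeps the rows distinct,
  and every outcome on the other questions occurs because its extension by \<open>b\<close> is in
  the window. Column \<open>k\<close> is constant there, so the single change between consecutive
  rows survives the removal.\<close>

lemma slice_gray:
  assumes s: "s + 2 ^ m \<le> 2 * 2 ^ m"
    and b: "\<And>i. i < 2 * 2 ^ m \<Longrightarrow> P $$ (i, k) = b \<longleftrightarrow> s \<le> i \<and> i < s + 2 ^ m"
  shows "slice s \<in> gray_matrices m"
proof -
  have dim: "slice s \<in> carrier_mat (2 ^ m) m"
    by (simp add: slice_def)
  have rows: "rows (slice s) = map (\<lambda>i. rest (s + i)) [0..<2 ^ m]"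
    using dim s by (auto simp: rows_def row_slice)
  have "inj_on (\<lambda>i. rest (s + i)) {..<2 ^ m}"
  proof (rule inj_onI)
    fix i i'
    assume i: "i \<in> {..<2 ^ m}" "i' \<in> {..<2 ^ m}" and eq: "rest (s + i) = rest (s + i')"
    then have less: "s + i < 2 * 2 ^ m" "s + i' < 2 * 2 ^ m"
      using s by auto
    then have "P $$ (s + i, k) = b" "P $$ (s + i', k) = b"
      using b i by simp_all
    then show "i = i'"
      using rest_inj[OF less eq] by simp
  qed
  then have "distinct (rows (slice s))"
    by (simp add: rows distinct_map atLeast0LessThan)
  moreover have "set (rows (slice s)) = outcomes m"
  proof (intro equalityI subsetI)
    fix x
    assume "x \<in> outcomes m"
    then obtain i where i: "i < 2 * 2 ^ m" "rest i = x" "P $$ (i, k) = b"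
      unfolding outcomes_def by (rule row_exists)
    then have "s \<le> i" "i - s < 2 ^ m"
      using b[of i] by auto
    then show "x \<in> set (rows (slice s))"
      using i unfolding rows by (auto intro!: image_eqI[of _ _ "i - s"])
  qed (auto simp: rows outcomes_def rest_in_carrier)
  moreover have "\<exists>!j. j < m \<and> slice s $$ (i, j) \<noteq> slice s $$ (Suc i, j)" if i: "Suc i < 2 ^ m" for i
  proof -
    let ?D = "\<lambda>j. P $$ (s + i, j) \<noteq> P $$ (Suc (s + i), j)"
    have "Suc (s + i) < 2 * 2 ^ m"
      using s i by linarith
    then have ex1: "\<exists>!j. j < Suc m \<and> ?D j" and nk: "\<not> ?D k"
      using gray b[of "s + i"] b[of "Suc (s + i)"] i by (simp_all add: gray_matrices_iff)
    then obtain j where j: "j < Suc m" "?D j" "j \<noteq> k"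
      and uniq: "\<And>j'. j' < Suc m \<Longrightarrow> ?D j' \<Longrightarrow> j' = j"
      by metis
    \<comment> \<open>Column \<open>j\<close> of \<open>P\<close> becomes column
      \<open>delete_index k j\<close> of the slice. A second changing column of the slice would come
      from a second one of \<open>P\<close>.\<close>
    have "\<exists>!j. j < m \<and> ?D (insert_index k j)"
    proof (rule ex1I[of _ "delete_index k j"])
      show "delete_index k j < m \<and> ?D (insert_index k (delete_index k j))"
        using j k_less by (simp add: insert_delete_index delete_index_less)
      show "j' = delete_index k j" if "j' < m \<and> ?D (insert_index k j')" for j'
        using uniq[of "insert_index k j'"] that by (auto simp: insert_index_less)
    qed
    moreover have "slice s $$ (i, j) \<noteq> slice s $$ (Suc i, j) \<longleftrightarrow> ?D (insert_index k j)" if "j < m" for j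
      using that i by (simp add: slice_def)
    ultimately show ?thesis
      by metis
  qed
  ultimately show ?thesis
    using dim by (simp add: gray_matrices_iff preference_matrix_def)
qed

text \<open>Removing column \<open>k\<close> and putting it back restores \<open>P\<close>, whatever
  the column looks like. Its shape decides only whether this is a \<open>stack1\<close> or a
  \<open>stack0\<close>, and whether the slices are Gray.\<close>

lemma insert_col_slices: "P = insert_col k (col P k) (slice 0 @\<^sub>r slice (2 ^ m))"
proof (rule eq_matI)
  fix i j
  assume "i < dim_row (insert_col k (col P k) (slice 0 @\<^sub>r slice (2 ^ m)))"
    and "j < dim_col (insert_col k (col P k) (slice 0 @\<^sub>r slice (2 ^ m)))"
  then have ij: "i < 2 * 2 ^ m" "j < Suc m"
    by (simp_all add: insert_col_def append_rows_def slice_def)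
  then show "P $$ (i, j) = insert_col k (col P k) (slice 0 @\<^sub>r slice (2 ^ m)) $$ (i, j)"
    using k_less delete_index_less[OF ij(2) k_less]
    by (cases "j = k") (auto simp: insert_col_def append_rows_def slice_def insert_delete_index)
qed (simp_all add: insert_col_def append_rows_def slice_def)

lemma halves_imp_slices:
  assumes b: "\<forall>i < 2 * 2 ^ m. P $$ (i, k) = b \<longleftrightarrow> i < 2 ^ m"
  shows "slice 0 \<in> gray_matrices m" and "slice (2 ^ m) \<in> successors m (slice 0)"
proof -
  show "slice 0 \<in> gray_matrices m"
    using b by (intro slice_gray[of _ b]) auto
  \<comment> \<open>The lower half is the window of the complementary value, so
    \<open>slice_gray\<close> applies to it with \<open>1 - b\<close>.\<close>
  have "P $$ (i, k) = 1 - b \<longleftrightarrow> 2 ^ m \<le> i \<and> i < 2 ^ m + 2 ^ m" if "i < 2 * 2 ^ m" for i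
  proof -
    have "P $$ (i, k) = 1 - b \<longleftrightarrow> P $$ (i, k) \<noteq> b"
      using bit_eq_complement[of b "P $$ (i, k)"] by auto
    then show ?thesis
      using b that by auto
  qed
  then have "slice (2 ^ m) \<in> gray_matrices m"
    by (intro slice_gray[of _ "1 - b"]) auto
  moreover have "row (slice (2 ^ m)) 0 = row (slice 0) (2 ^ m - 1)"
  proof -
    have less: "2 ^ m - 1 < (2 :: nat) * 2 ^ m"
      by (simp add: less_imp_diff_less)
    \<comment> \<open>These are the rows adjacent to the cut. They differ in column
      \<open>k\<close>, hence agree in all others, which is the gluing condition of
      \<open>successors\<close>.\<close>
    then have "P $$ (2 ^ m - 1, k) \<noteq> P $$ (2 ^ m, k)"
      using b[rule_format, of "2 ^ m - 1"] b[rule_format, of "2 ^ m"] by auto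
    then have "rest (2 ^ m) = rest (2 ^ m - 1)"
      using rest_Suc[of "2 ^ m - 1"] by simp
    then show ?thesis
      using row_slice[of 0 "2 ^ m"] row_slice[of "2 ^ m - 1" 0] less by simp
  qed
  moreover have "dim_row (slice 0) = 2 ^ m"
    by (simp add: slice_def)
  ultimately show "slice (2 ^ m) \<in> successors m (slice 0)"
    by (simp add: successors_def)
qed

end

theorem theorem5:
  fixes n k :: nat and P :: "bit mat"
  assumes "P \<in> gray_matrices n" and "k \<in> questions n"
  shows "(separable n P {k} \<longleftrightarrow>
            col P k = ones_zeros (2 ^ (n - 1)) \<or> col P k = complement (ones_zeros (2 ^ (n - 1))))
       \<and> (col P k = ones_zeros (2 ^ (n - 1)) \<or> col P k = complement (ones_zeros (2 ^ (n - 1)))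
            \<longleftrightarrow> (\<exists>P1 \<in> gray_matrices (n - 1). \<exists>P2 \<in> successors (n - 1) P1.
                   P = stack1 k P1 P2 \<or> P = stack0 k P1 P2))"
proof -
  \<comment> \<open>A question exists, so \<open>n\<close> is positive and \<open>n - 1\<close> is
    not truncated.\<close>
  obtain m where n: "n = Suc m"
    using assms(2) by (cases n) (auto simp: questions_def)
  interpret gray_question m k P
    using assms by unfold_locales (simp_all add: n questions_def)
  let ?Z = "ones_zeros (2 ^ m)"
  have halves: "col P k = ?Z \<or> col P k = complement ?Z \<longleftrightarrow>
      (\<exists>b. \<forall>i < 2 * 2 ^ m. P $$ (i, k) = b \<longleftrightarrow> i < 2 ^ m)"
    using k_less by (intro col_eq_ones_zeros_iff) simp_all
  have "\<exists>P1 \<in> gray_matrices m. \<exists>P2 \<in> successors m P1. P = stack1 k P1 P2 \<or> P = stack0 k P1 P2"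
    if "col P k = ?Z \<or> col P k = complement ?Z"
  proof -
    have "slice 0 \<in> gray_matrices m" "slice (2 ^ m) \<in> successors m (slice 0)"
      using that halves halves_imp_slices by blast+
    moreover have "dim_row (slice 0) = 2 ^ m"
      by (simp add: slice_def)
    then have "P = stack1 k (slice 0) (slice (2 ^ m)) \<or> P = stack0 k (slice 0) (slice (2 ^ m))"
      using that insert_col_slices by (auto simp: stack1_def stack0_def)
    ultimately show ?thesis
      by blast
  qed
  moreover have "col P k = ?Z \<or> col P k = complement ?Z"
    if P1: "P1 \<in> gray_matrices m" and P2: "P2 \<in> successors m P1"
      and P: "P = stack1 k P1 P2 \<or> P = stack0 k P1 P2" for P1 P2
  proof -
    have "dim_row P1 = 2 ^ m" "dim_col P1 = m" "dim_row P2 = 2 ^ m"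
      using P1 P2 by (auto simp: successors_def gray_matrices_def preference_matrix_def)
    \<comment> \<open>A stacked matrix shows the inserted vector unchanged as its column
      \<open>k\<close>, which gives the shape of the column at once.\<close>
    then have "col (insert_col k v (P1 @\<^sub>r P2)) k = v" if "dim_vec v = 2 * 2 ^ m" for v
      using that k_less by (intro col_insert_col) (simp_all add: append_rows_def)
    with P \<open>dim_row P1 = 2 ^ m\<close> show ?thesis
      by (auto simp: stack1_def stack0_def)
  qed
  ultimately show ?thesis
    using halves separable_iff_halves unfolding n by auto
qed

end
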